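(* Let $m_1=m_3=+1$ and $m_2=-1$. Let $\mathbf X^0=(\mathbf x_1^0,\mathbf x_2^0,\mathbf x_3^0)\in\mathbb R_*^{2\times3}$ be any initial data, let $\mathbf X(t)=(\mathbf x_1(t),\mathbf x_2(t),\mathbf x_3(t))$, $0\le t<T_{\max}$, be the solution of $$\dot{\mathbf x}_j(t)=2m_j\sum_{k=1,k\ne j}^3 m_k\frac{\mathbf x_j(t)-\mathbf x_k(t)}{|\mathbf x_j(t)-\mathbf x_k(t)|^2},\qquad \mathbf x_j(0)=\mathbf x_j^0,\qquad 1\le j\le 3,$$ and let $H_1^0=\sum_{1\le j<l\le3}|\mathbf x_j^0-\mathbf x_l^0|^2$ and $\bar{\mathbf x}^0=\frac13\sum_{j=1}^3\mathbf x_j^0$. Then: (i) If $|\mathbf x_1^0-\mathbf x_2^0|=|\mathbf x_2^0-\mathbf x_3^0|$, then the three vortices form a collision cluster and they collide at $\bar{\mathbf x}^0$ as $t\to T_{\max}^-$, with $T_{\max}=\frac{H_1^0}{12}$. (ii) If $|\mathbf x_1^0-\mathbf x_2^0|<|\mathbf x_2^0-\mathbf x_3^0|$, then only $\mathbf x_1$ and $\mathbf x_2$ form a collision cluster; and if $|\mathbf x_1^0-\mathbf x_2^0|>|\mathbf x_2^0-\mathbf x_3^0|$, then only $\mathbf x_2$ and $\mathbf x_3$ form a collision cluster. Moreover, in these cases the collision time satisfies $0<T_{\max}<\frac{H_1^0}{12}$.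
   Context: $\mathbb R_*^{2\times N}:=\{(\mathbf x_1,\dots,\mathbf x_N)\in\mathbb R^{2\times N} : \mathbf x_j\neq\mathbf x_l\in\mathbb R^2 \text{ for } 1\le j<l\le N\}$. $T_{\max}:=\sup\{t\ge 0 : \mathbf x_j(t)\ne\mathbf x_l(t)\text{ for all }1\le j\ne l\le N\}$. Write $d_{jl}(t)=|\mathbf x_j(t)-\mathbf x_l(t)|$. For a set $I\subseteq\{1,\dots,N\}$ with at least two elements, the vortices in $I$ form a (finite time) collision cluster among the $N$ vortices if there are a finite time $0<T_c<+\infty$ and a point $\mathbf x^0\in\mathbb R^2$ such that $\min_{1\le j<l\le N}d_{jl}(t)>0$ for $0\le t<T_c$, $\lim_{t\to T_c^-}\mathbf x_j(t)=\mathbf x^0$ for all $j\in I$, and $\min_{j\in I}d_{jl}(t)>0$ for $0\le t\le T_c$ and every $l\in\{1,\dots,N\}\setminus I$ (values at $t=T_c$ being understood as limits as $t\to T_c^-$). Here $N=3$. *)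

theory Defs
  imports "HOL-Analysis.Analysis" "HOL-Library.Extended_Real"
begin

text \<open>
  A configuration of vortices in the plane is a value of type \<open>real^2^'n\<close>: the vortex with label
  \<open>j\<close> sits at \<open>X $ j\<close>. For three vortices the index type is \<open>3\<close>, whose elements are
  \<open>1\<close>, \<open>2\<close>, \<open>3\<close>.
\<close>

definition distinct_configs :: "(real^2^'n::finite) set" where
  "distinct_configs = {X. \<forall>j l. j \<noteq> l \<longrightarrow> X $ j \<noteq> X $ l}"

definition vortex_field :: "real^'n \<Rightarrow> real^2^'n \<Rightarrow> real^2^'n::finite" where
  "vortex_field m X =
     (\<chi> j. (2 * m $ j) *\<^sub>R
        (\<Sum>k\<in>UNIV - {j}. (m $ k / (norm (X $ j - X $ k))\<^sup>2) *\<^sub>R (X $ j - X $ k)))"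

text \<open>
  \<open>vortex_solution m X0 S X\<close>: \<open>X\<close> solves the initial value problem on the interval \<open>S\<close> of times,
  which starts at \<open>0\<close>; the derivative at an endpoint is one-sided. Distinctness of the vortices
  has to be required separately, because division by zero makes \<open>vortex_field\<close> total.
\<close>

definition vortex_solution ::
  "real^'n \<Rightarrow> real^2^'n \<Rightarrow> real set \<Rightarrow> (real \<Rightarrow> real^2^'n::finite) \<Rightarrow> bool" where
  "vortex_solution m X0 S X \<longleftrightarrow> X 0 = X0 \<and>
     (\<forall>t\<in>S. X t \<in> distinct_configs \<and>
        (X has_vector_derivative vortex_field m (X t)) (at t within S))"

text \<open>
  The supremum of the times \<open>t\<close> at which the vortices are pairwise distinct. A solution is only
  defined until its first collision, so such a \<open>t\<close> is one for which the solution through \<open>X0\<close>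
  exists, with distinct vortices, on all of \<open>[0, t]\<close>. A priori the supremum may be infinite.
\<close>

definition T_max :: "real^'n \<Rightarrow> real^2^'n::finite \<Rightarrow> ereal" where
  "T_max m X0 = Sup {ereal t | t. 0 \<le> t \<and> (\<exists>X. vortex_solution m X0 {0..t} X)}"

text \<open>
  The vortices in \<open>I\<close> collide at time \<open>Tc\<close> in the point \<open>p\<close>, and no other vortex joins them.
  \<open>T\<close> is the end of the life span of the trajectory \<open>X\<close>: the values \<open>X t\<close> carry no meaning for
  \<open>t \<ge> T\<close>, whence \<open>Tc \<le> T\<close>. The last conjunct is positivity of the distance between the cluster
  and an outside vortex on \<open>[0, Tc]\<close>, its value at \<open>Tc\<close> being the limit from the left.
\<close>

definition collision_cluster_at ::
  "ereal \<Rightarrow> (real \<Rightarrow> real^2^'n::finite) \<Rightarrow> 'n set \<Rightarrow> real \<Rightarrow> real^2 \<Rightarrow> bool" where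
  "collision_cluster_at T X I Tc p \<longleftrightarrow>
     2 \<le> card I \<and> 0 < Tc \<and> ereal Tc \<le> T \<and>
     (\<forall>t. 0 \<le> t \<and> t < Tc \<longrightarrow> (\<forall>j l. j \<noteq> l \<longrightarrow> 0 < dist (X t $ j) (X t $ l))) \<and>
     (\<forall>j\<in>I. ((\<lambda>t. X t $ j) \<longlongrightarrow> p) (at_left Tc)) \<and>
     (\<forall>l. l \<notin> I \<longrightarrow>
        (\<forall>t. 0 \<le> t \<and> t < Tc \<longrightarrow> 0 < (MIN j\<in>I. dist (X t $ j) (X t $ l))) \<and>
        (\<exists>d>0. ((\<lambda>t. MIN j\<in>I. dist (X t $ j) (X t $ l)) \<longlongrightarrow> d) (at_left Tc)))"

definition collision_cluster :: "ereal \<Rightarrow> (real \<Rightarrow> real^2^'n::finite) \<Rightarrow> 'n set \<Rightarrow> bool" where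
  "collision_cluster T X I \<longleftrightarrow> (\<exists>Tc p. collision_cluster_at T X I Tc p)"

definition H1 :: "real^2^3 \<Rightarrow> real" where
  "H1 X = (dist (X $ 1) (X $ 2))\<^sup>2 + (dist (X $ 1) (X $ 3))\<^sup>2 + (dist (X $ 2) (X $ 3))\<^sup>2"

definition barycenter :: "real^2^3 \<Rightarrow> real^2" where
  "barycenter X = (1 / 3) *\<^sub>R (\<Sum>j\<in>UNIV. X $ j)"

end

(* Let A, B, C be the squared lengths of the sides x1x2, x2x3, x1x3 of the vortex triangle. Then
   A + B + C decreases at the constant rate 12, so there is a collision by the time H1 / 12, and
   u = (B - A) C solves u' = h u with h = 2 (C - A - B)^2 / (A B C) + 4 / C >= 0.
   If A = B initially, this persists; the parallelogram law C <= 4 A and a lower bound for C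
   then exclude any collision before A + B + C vanishes, which is the total collision at the
   barycenter. If A < B initially, u can only grow, hence B and C stay away from 0, so A has to
   vanish, and it does so before A + B + C reaches 0. The third vortex has bounded velocity and
   therefore a limit, and since the barycenter is fixed, so do the two colliding ones.
   That some distance must vanish at T_max is the usual continuation argument, based on
   a local existence time that depends on the smallest initial distance only. *)

theory Submission
  imports Defs
begin

section \<open>Local solvability of autonomous Lipschitz equations\<close>

text \<open>Picard's integral operator is a contraction on the bounded continuous functions. A curve
  of speed at most \<open>M\<close> cannot leave the ball before time \<open>e\<close>, because
  \<open>e * M \<le> r\<close>.\<close>

lemma cauchy_lipschitz_cball:
  fixes F :: "'a::euclidean_space \<Rightarrow> 'a"
  assumes r: "0 \<le> r"
    and lip: "\<And>x y. x \<in> cball x0 r \<Longrightarrow> y \<in> cball x0 r \<Longrightarrow> dist (F x) (F y) \<le> L * dist x y"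
    and bound: "\<And>x. x \<in> cball x0 r \<Longrightarrow> norm (F x) \<le> M"
    and e: "0 \<le> e" "e * M \<le> r" and L: "0 \<le> L" "e * L < 1"
  shows "\<exists>Y. Y 0 = x0 \<and> (\<forall>t\<in>{0..e}. Y t \<in> cball x0 r \<and>
           (Y has_vector_derivative F (Y t)) (at t within {0..e}))"
proof -
  \<comment> \<open>The projection onto a ball is 1-Lipschitz, so \<open>G\<close> has on the whole
    space the bound and Lipschitz constant that \<open>F\<close> has on the ball. The fixed point
    turns out to stay in the ball, where \<open>G\<close> and \<open>F\<close> agree.\<close>
  define G where "G x = F (closest_point (cball x0 r) x)" for x
  have cp: "closest_point (cball x0 r) x \<in> cball x0 r" for x
    using r by (intro closest_point_in_set) auto
  have G_bound: "norm (G x) \<le> M" for x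
    unfolding G_def by (intro bound cp)
  have G_lip: "dist (G x) (G y) \<le> L * dist x y" for x y
  proof -
    have "dist (G x) (G y) \<le> L * dist (closest_point (cball x0 r) x) (closest_point (cball x0 r) y)"
      unfolding G_def by (intro lip cp)
    also have "\<dots> \<le> L * dist x y"
      using r L by (intro mult_left_mono closest_point_lipschitz) auto
    finally show ?thesis .
  qed
  have "L-lipschitz_on UNIV G"
    using G_lip L by (auto simp: lipschitz_on_def)
  then have G_cont: "continuous_on UNIV G"
    by (rule lipschitz_on_continuous_on)
  have Gf_cont: "continuous_on S (\<lambda>s. G (apply_bcontfun f s))" for S and f :: "real \<Rightarrow>\<^sub>C 'a"
    by (intro continuous_on_compose2[OF G_cont]) auto
  have Gf_int: "(\<lambda>s. G (apply_bcontfun f s)) integrable_on {a..b}" for a b and f :: "real \<Rightarrow>\<^sub>C 'a"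
    by (intro integrable_continuous_real Gf_cont)
  \<comment> \<open>Freezing the upper limit of integration outside \<open>{0..e}\<close> makes
    \<open>\<Phi> f\<close> bounded and continuous on the whole line, so that Banach's theorem
    applies to the entire type of bounded continuous functions.\<close>
  define clip where "clip t = max 0 (min e t)" for t :: real
  have clip: "clip t \<in> {0..e}" for t
    using e by (auto simp: clip_def)
  define \<Phi> where "\<Phi> f t = x0 + integral {0..clip t} (\<lambda>s. G (apply_bcontfun f s))"
    for f :: "real \<Rightarrow>\<^sub>C 'a" and t
  have step: "norm (integral {0..clip t} (\<lambda>s. G (apply_bcontfun f s))) \<le> e * M" for f t
  proof -
    have "0 \<le> M" using G_bound[of x0] norm_ge_zero[of "G x0"] by linarith
    have "norm (integral {0..clip t} (\<lambda>s. G (apply_bcontfun f s))) \<le> M * (clip t - 0)"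
      using clip[of t] G_bound by (intro integral_bound Gf_cont) auto
    also have "\<dots> \<le> e * M"
      using clip[of t] \<open>0 \<le> M\<close> by (simp add: mult.commute[of e] mult_left_mono)
    finally show ?thesis .
  qed
  have \<Phi>_bcontfun: "\<Phi> f \<in> bcontfun" for f
  proof (rule bcontfun_normI)
    have "continuous_on {0..e} (\<lambda>t. integral {0..t} (\<lambda>s. G (apply_bcontfun f s)))"
      by (rule indefinite_integral_continuous_1[OF Gf_int])
    moreover have "continuous_on UNIV clip"
      unfolding clip_def by (intro continuous_intros)
    ultimately have "continuous_on UNIV (\<lambda>t. integral {0..clip t} (\<lambda>s. G (apply_bcontfun f s)))"
      by (rule continuous_on_compose2) (use clip in blast)
    then show "continuous_on UNIV (\<Phi> f)"
      unfolding \<Phi>_def by (rule continuous_on_add[OF continuous_on_const])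
    show "norm (\<Phi> f t) \<le> norm x0 + e * M" for t
      unfolding \<Phi>_def using step[where f=f and t=t] norm_triangle_ineq[of x0] by (smt (verit))
  qed
  have "\<exists>!f. Bcontfun (\<Phi> f) = f"
  proof (rule banach_fix_type)
    show "0 \<le> e * L" "e * L < 1" using e L by auto
    show "\<forall>f g. dist (Bcontfun (\<Phi> f)) (Bcontfun (\<Phi> g)) \<le> e * L * dist f g"
    proof (intro allI dist_bound)
      fix f g :: "real \<Rightarrow>\<^sub>C 'a" and t
      have "dist (\<Phi> f t) (\<Phi> g t)
          = norm (integral {0..clip t} (\<lambda>s. G (apply_bcontfun f s) - G (apply_bcontfun g s)))"
        by (simp add: \<Phi>_def dist_norm Henstock_Kurzweil_Integration.integral_diff[OF Gf_int Gf_int])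
      also have "\<dots> \<le> L * dist f g * (clip t - 0)"
      proof (rule integral_bound)
        show "0 \<le> clip t" using clip[of t] by auto
        show "continuous_on {0..clip t} (\<lambda>s. G (apply_bcontfun f s) - G (apply_bcontfun g s))"
          by (intro continuous_on_diff Gf_cont)
        show "norm (G (apply_bcontfun f s) - G (apply_bcontfun g s)) \<le> L * dist f g" for s
          using order_trans[OF G_lip mult_left_mono[OF dist_bounded[of f s g] L(1)]]
          by (simp add: dist_norm)
      qed
      also have "\<dots> \<le> e * L * dist f g"
        using clip[of t] L mult_left_mono[of "clip t" e "L * dist f g"] by (simp add: algebra_simps)
      finally show "dist (apply_bcontfun (Bcontfun (\<Phi> f)) t) (apply_bcontfun (Bcontfun (\<Phi> g)) t)
          \<le> e * L * dist f g"
        by (simp add: Bcontfun_inverse[OF \<Phi>_bcontfun])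
    qed
  qed
  then obtain f where "Bcontfun (\<Phi> f) = f" by auto
  then have fix_f: "apply_bcontfun f t = \<Phi> f t" for t
    by (metis Bcontfun_inverse[OF \<Phi>_bcontfun])
  have in_ball: "apply_bcontfun f t \<in> cball x0 r" for t
    using step[of t f] e by (simp add: fix_f[of t] \<Phi>_def dist_norm)
  moreover have "(apply_bcontfun f has_vector_derivative F (apply_bcontfun f t)) (at t within {0..e})"
    if t: "t \<in> {0..e}" for t
  proof -
    have "((\<lambda>t. x0 + integral {0..t} (\<lambda>s. G (apply_bcontfun f s))) has_vector_derivative
        0 + G (apply_bcontfun f t)) (at t within {0..e})"
      by (intro has_vector_derivative_add has_vector_derivative_const
          integral_has_vector_derivative Gf_cont t)
    then have "(apply_bcontfun f has_vector_derivative 0 + G (apply_bcontfun f t)) (at t within {0..e})"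
    proof (rule has_vector_derivative_weaken[OF _ t subset_refl])
      fix s assume "s \<in> {0..e}"
      then show "x0 + integral {0..s} (\<lambda>s. G (apply_bcontfun f s)) = apply_bcontfun f s"
        unfolding fix_f[of s] \<Phi>_def by (simp add: clip_def)
    qed
    then show ?thesis
      unfolding G_def by (simp only: closest_point_self[OF in_ball] add_0)
  qed
  moreover have "apply_bcontfun f 0 = x0"
    using e by (simp add: fix_f[of 0] \<Phi>_def clip_def)
  ultimately show ?thesis by (intro exI[of _ "apply_bcontfun f"]) simp
qed

section \<open>Bounds for the vortex field on separated configurations\<close>

text \<open>Each interaction term of the field is a multiple of the inversion in the unit sphere.
  After squaring, both sides expand to the same expression in inner products. So inversion is
  Lipschitz with constant \<open>1 / \<delta>\<^sup>2\<close> on vectors of length at least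
  \<open>\<delta>\<close>.\<close>

lemma norm_inversion_diff:
  fixes x y :: "'a::real_inner"
  assumes "x \<noteq> 0" "y \<noteq> 0"
  shows "norm ((1 / (norm x)\<^sup>2) *\<^sub>R x - (1 / (norm y)\<^sup>2) *\<^sub>R y) = norm (x - y) / (norm x * norm y)"
proof -
  have "(norm ((1 / (norm x)\<^sup>2) *\<^sub>R x - (1 / (norm y)\<^sup>2) *\<^sub>R y))\<^sup>2
      = (norm (x - y) / (norm x * norm y))\<^sup>2"
    using assms
    by (simp add: power2_norm_eq_inner inner_diff inner_commute power_divide power_mult_distrib)
       (simp add: field_simps power2_eq_square)
  then show ?thesis
    by (simp add: power2_eq_iff_nonneg)
qed

text \<open>A quantitative form of distinctness: bounds for the field, and with them the existence
  time, then depend on \<open>\<delta>\<close> alone.\<close>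

definition separated :: "real \<Rightarrow> real^2^'n::finite \<Rightarrow> bool" where
  "separated \<delta> X \<longleftrightarrow> (\<forall>j l. j \<noteq> l \<longrightarrow> \<delta> \<le> dist (X $ j) (X $ l))"

lemma separated_imp_distinct:
  assumes "0 < \<delta>" "separated \<delta> X"
  shows "X \<in> distinct_configs"
proof -
  have "X $ j \<noteq> X $ l" if "j \<noteq> l" for j l
    using assms that unfolding separated_def by (metis dist_self not_less)
  then show ?thesis by (simp add: distinct_configs_def)
qed

lemma distinct_imp_separated:
  fixes X :: "real^2^'n::finite"
  assumes "X \<in> distinct_configs"
  shows "\<exists>\<delta>>0. separated \<delta> X"
proof -
  \<comment> \<open>Inserting \<open>1\<close> keeps the set nonempty when there is only one
    vortex.\<close>
  define D where "D = insert 1 ((\<lambda>(j, l). dist (X $ j) (X $ l)) ` {(j, l). j \<noteq> l})"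
  have "finite D" unfolding D_def by (intro finite.insertI finite_imageI finite)
  moreover have "\<forall>d\<in>D. 0 < d"
    using assms by (auto simp: D_def distinct_configs_def)
  ultimately have "0 < Min D" by (subst Min_gr_iff) (auto simp: D_def)
  moreover have "separated (Min D) X"
    unfolding separated_def using \<open>finite D\<close> by (auto simp: D_def intro!: Min_le)
  ultimately show ?thesis by blast
qed

lemma separated_cball:
  fixes X Y :: "real^2^'n::finite"
  assumes "separated \<delta> X" "Y \<in> cball X (\<delta> / 4)"
  shows "separated (\<delta> / 2) Y"
  unfolding separated_def
proof (intro allI impI)
  fix j l :: 'n assume "j \<noteq> l"
  then have "\<delta> \<le> dist (X $ j) (X $ l)" using assms(1) by (simp add: separated_def)
  moreover have "dist (X $ j) (Y $ j) \<le> \<delta> / 4" "dist (X $ l) (Y $ l) \<le> \<delta> / 4"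
    using assms(2) dist_vec_nth_le[of X j Y] dist_vec_nth_le[of X l Y] by auto
  ultimately show "\<delta> / 2 \<le> dist (Y $ j) (Y $ l)" by metric
qed

lemma norm_vec_le_sum:
  fixes x :: "'a::real_normed_vector^'n::finite"
  shows "norm x \<le> (\<Sum>j\<in>UNIV. norm (x $ j))"
  by (simp add: norm_vec_def L2_set_le_sum)

lemma vortex_field_bound:
  fixes X :: "real^2^'n::finite"
  assumes "0 < \<delta>" "separated \<delta> X"
  shows "norm (vortex_field m X) \<le> (\<Sum>j\<in>UNIV. 2 * \<bar>m $ j\<bar> * (\<Sum>k\<in>UNIV - {j}. \<bar>m $ k\<bar> / \<delta>))"
proof (rule order_trans[OF norm_vec_le_sum sum_mono])
  fix j
  have "norm (vortex_field m X $ j) =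
      2 * \<bar>m $ j\<bar> * norm (\<Sum>k\<in>UNIV - {j}. (m $ k / (norm (X $ j - X $ k))\<^sup>2) *\<^sub>R (X $ j - X $ k))"
    by (simp add: vortex_field_def abs_mult)
  also have "\<dots> \<le> 2 * \<bar>m $ j\<bar> * (\<Sum>k\<in>UNIV - {j}. \<bar>m $ k\<bar> / \<delta>)"
  proof (intro mult_left_mono sum_norm_le)
    fix k assume "k \<in> UNIV - {j}"
    then have "\<delta> \<le> norm (X $ j - X $ k)"
      using assms by (auto simp: separated_def dist_norm)
    moreover from this have "norm ((m $ k / (norm (X $ j - X $ k))\<^sup>2) *\<^sub>R (X $ j - X $ k))
        = \<bar>m $ k\<bar> / norm (X $ j - X $ k)"
      using assms(1) by (auto simp: power2_eq_square)
    ultimately show "norm ((m $ k / (norm (X $ j - X $ k))\<^sup>2) *\<^sub>R (X $ j - X $ k)) \<le> \<bar>m $ k\<bar> / \<delta>"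
      using assms(1) by (simp add: frac_le)
  qed auto
  finally show "norm (vortex_field m X $ j) \<le> 2 * \<bar>m $ j\<bar> * (\<Sum>k\<in>UNIV - {j}. \<bar>m $ k\<bar> / \<delta>)" .
qed

lemma vortex_field_lipschitz:
  fixes X Y :: "real^2^'n::finite"
  assumes "0 < \<delta>" "separated \<delta> X" "separated \<delta> Y"
  shows "dist (vortex_field m X) (vortex_field m Y)
    \<le> (\<Sum>j\<in>UNIV. 2 * \<bar>m $ j\<bar> * (\<Sum>k\<in>UNIV - {j}. \<bar>m $ k\<bar> * (2 / \<delta>\<^sup>2))) * dist X Y"
  unfolding dist_norm sum_distrib_right
proof (rule order_trans[OF norm_vec_le_sum sum_mono])
  fix j
  define \<phi> where "\<phi> x = (1 / (norm x)\<^sup>2) *\<^sub>R x" for x :: "real^2"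
  have "vortex_field m X $ j - vortex_field m Y $ j =
      (2 * m $ j) *\<^sub>R (\<Sum>k\<in>UNIV - {j}. m $ k *\<^sub>R (\<phi> (X $ j - X $ k) - \<phi> (Y $ j - Y $ k)))"
    by (simp add: vortex_field_def \<phi>_def scaleR_diff_right sum_subtractf)
  then have "norm ((vortex_field m X - vortex_field m Y) $ j) = 2 * \<bar>m $ j\<bar> *
      norm (\<Sum>k\<in>UNIV - {j}. m $ k *\<^sub>R (\<phi> (X $ j - X $ k) - \<phi> (Y $ j - Y $ k)))"
    by (simp add: abs_mult)
  also have "\<dots> \<le> 2 * \<bar>m $ j\<bar> * (\<Sum>k\<in>UNIV - {j}. \<bar>m $ k\<bar> * (2 / \<delta>\<^sup>2) * norm (X - Y))"
  proof (intro mult_left_mono sum_norm_le)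
    fix k assume "k \<in> UNIV - {j}"
    then have sep: "\<delta> \<le> norm (X $ j - X $ k)" "\<delta> \<le> norm (Y $ j - Y $ k)"
      using assms by (auto simp: separated_def dist_norm)
    then have ne: "X $ j - X $ k \<noteq> 0" "Y $ j - Y $ k \<noteq> 0"
      using assms(1) by auto
    have "norm ((X $ j - X $ k) - (Y $ j - Y $ k)) = norm ((X - Y) $ j - (X - Y) $ k)"
      by (simp add: algebra_simps)
    \<comment> \<open>The factor 2 in the Lipschitz constant arises because both vortices of a pair
      are displaced.\<close>
    also have "\<dots> \<le> 2 * norm (X - Y)"
      using norm_triangle_ineq4[of "(X - Y) $ j" "(X - Y) $ k"]
        Finite_Cartesian_Product.norm_nth_le[of "X - Y" j]
        Finite_Cartesian_Product.norm_nth_le[of "X - Y" k] by linarith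
    finally have "norm (\<phi> (X $ j - X $ k) - \<phi> (Y $ j - Y $ k)) \<le> 2 * norm (X - Y) / (\<delta> * \<delta>)"
      unfolding \<phi>_def norm_inversion_diff[OF ne]
      using assms(1) sep by (intro frac_le mult_mono) auto
    then show "norm (m $ k *\<^sub>R (\<phi> (X $ j - X $ k) - \<phi> (Y $ j - Y $ k)))
        \<le> \<bar>m $ k\<bar> * (2 / \<delta>\<^sup>2) * norm (X - Y)"
      using mult_left_mono[of _ _ "\<bar>m $ k\<bar>"] by (fastforce simp: power2_eq_square)
  qed auto
  finally show "norm ((vortex_field m X - vortex_field m Y) $ j)
      \<le> 2 * \<bar>m $ j\<bar> * (\<Sum>k\<in>UNIV - {j}. \<bar>m $ k\<bar> * (2 / \<delta>\<^sup>2)) * norm (X - Y)"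
    by (simp add: sum_distrib_right mult.assoc)
qed

section \<open>Uniform existence times and continuation\<close>

text \<open>The order of the quantifiers matters: one \<open>e\<close> serves all
  \<open>\<delta>\<close>-separated data, so restarting close to the maximal time gains a fixed
  amount of time.\<close>

lemma vortex_local_existence:
  fixes m :: "real^'n::finite"
  assumes "0 < \<delta>"
  shows "\<exists>e>0. \<forall>X0. separated \<delta> X0 \<longrightarrow> (\<exists>X. vortex_solution m X0 {0..e} X)"
proof -
  define M where "M = (\<Sum>j\<in>UNIV. 2 * \<bar>m $ j\<bar> * (\<Sum>k\<in>UNIV - {j}. \<bar>m $ k\<bar> / (\<delta> / 2)))"
  define L where "L = (\<Sum>j\<in>UNIV. 2 * \<bar>m $ j\<bar> * (\<Sum>k\<in>UNIV - {j}. \<bar>m $ k\<bar> * (2 / (\<delta> / 2)\<^sup>2)))"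
  \<comment> \<open>The two terms keep the curve in the ball of radius \<open>\<delta> / 4\<close>,
    where vortices remain \<open>\<delta> / 2\<close> apart, and make the operator contract. Adding
    1 avoids division by zero and makes \<open>e * L < 1\<close> strict.\<close>
  define e where "e = min (\<delta> / 4 / (M + 1)) (1 / (L + 1))"
  have M: "0 \<le> M" and L: "0 \<le> L"
    unfolding M_def L_def using assms by (intro sum_nonneg mult_nonneg_nonneg divide_nonneg_nonneg; simp)+
  then have e: "0 < e" using assms by (simp add: e_def)
  have "e \<le> \<delta> / 4 / (M + 1)" "e \<le> 1 / (L + 1)" by (simp_all add: e_def)
  then have "e * (M + 1) \<le> \<delta> / 4" "e * (L + 1) \<le> 1"
    using M L by (simp_all only: pos_le_divide_eq add_nonneg_pos zero_less_one)
  then have eM: "e * M \<le> \<delta> / 4" and eL: "e * L < 1"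
    using e by (simp_all add: distrib_left)
  have "\<exists>X. vortex_solution m X0 {0..e} X" if X0: "separated \<delta> X0" for X0
  proof -
    have sep: "separated (\<delta> / 2) Y" if "Y \<in> cball X0 (\<delta> / 4)" for Y
      using separated_cball[OF X0 that] .
    have "\<exists>Y. Y 0 = X0 \<and> (\<forall>t\<in>{0..e}. Y t \<in> cball X0 (\<delta> / 4) \<and>
           (Y has_vector_derivative vortex_field m (Y t)) (at t within {0..e}))"
    proof (rule cauchy_lipschitz_cball)
      show "dist (vortex_field m x) (vortex_field m y) \<le> L * dist x y"
        if "x \<in> cball X0 (\<delta> / 4)" "y \<in> cball X0 (\<delta> / 4)" for x y
        unfolding L_def using assms that by (intro vortex_field_lipschitz sep) auto
      show "norm (vortex_field m x) \<le> M" if "x \<in> cball X0 (\<delta> / 4)" for x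
        unfolding M_def using assms that by (intro vortex_field_bound sep) auto
    qed (use assms e eM eL L in auto)
    then show ?thesis
      unfolding vortex_solution_def
      using separated_imp_distinct[OF _ sep] assms by (metis half_gt_zero)
  qed
  then show ?thesis using e by blast
qed

text \<open>The equation is autonomous, so a time shift of \<open>Y\<close> is again a solution. At
  the junction \<open>s\<close> both pieces have the same value and hence the same one-sided
  derivative.\<close>

lemma vortex_solution_append:
  assumes X: "vortex_solution m X0 {0..s} X" and Y: "vortex_solution m (X s) {0..e} Y"
    and "0 \<le> s" "0 \<le> e"
  shows "vortex_solution m X0 {0..s + e} (\<lambda>t. if t \<in> {0..s} then X t else Y (t - s))"
  unfolding vortex_solution_def
proof (intro conjI ballI)
  let ?Z = "\<lambda>t. if t \<in> {0..s} then X t else Y (t - s)"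
  show "?Z 0 = X0" using X \<open>0 \<le> s\<close> by (simp add: vortex_solution_def)
  fix t assume t: "t \<in> {0..s + e}"
  show "?Z t \<in> distinct_configs"
    using X Y t by (auto simp: vortex_solution_def)
  have "((\<lambda>t. if t \<in> {0..s} then X t else Y (t - s)) has_vector_derivative
      (if t \<in> {0..s} then vortex_field m (X t) else vortex_field m (Y (t - s)))) (at t within {0..s + e})"
  proof (rule has_vector_derivative_If_within_closures)
    show "t \<in> {0..s} \<union> {s..s + e}" "{0..s + e} = {0..s} \<union> {s..s + e}"
      using t \<open>0 \<le> s\<close> \<open>0 \<le> e\<close> by auto
    have sub: "{0..s} \<union> closure {0..s} \<inter> closure {s..s + e} = {0..s}"
       "{s..s + e} \<union> closure {0..s} \<inter> closure {s..s + e} = {s..s + e}"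
      using \<open>0 \<le> s\<close> \<open>0 \<le> e\<close> by auto
    show "(X has_vector_derivative vortex_field m (X t))
        (at t within {0..s} \<union> closure {0..s} \<inter> closure {s..s + e})"
      if "t \<in> {0..s} \<union> closure {0..s} \<inter> closure {s..s + e}"
      using that X unfolding sub by (simp add: vortex_solution_def)
    show "((\<lambda>t. Y (t - s)) has_vector_derivative vortex_field m (Y (t - s)))
        (at t within {s..s + e} \<union> closure {0..s} \<inter> closure {s..s + e})"
      if "t \<in> {s..s + e} \<union> closure {0..s} \<inter> closure {s..s + e}"
    proof -
      have "t - s \<in> {0..e}" using that unfolding sub by auto
      moreover have "(\<lambda>t. t - s) ` {s..s + e} = {0..e}"
        by (auto intro!: image_eqI[where x="_ + s"])
      ultimately have "((Y \<circ> (\<lambda>t. t - s)) has_vector_derivative 1 *\<^sub>R vortex_field m (Y (t - s)))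
          (at t within {s..s + e})"
        using Y unfolding vortex_solution_def
        by (intro vector_diff_chain_within derivative_eq_intros) (auto intro!: derivative_eq_intros)
      then show ?thesis unfolding sub by (simp add: o_def)
    qed
    show "X t = Y (t - s)" "vortex_field m (X t) = vortex_field m (Y (t - s))"
      if "t \<in> closure {0..s}" "t \<in> closure {s..s + e}"
      using that Y by (auto simp: vortex_solution_def)
  qed
  then show "(?Z has_vector_derivative vortex_field m (?Z t)) (at t within {0..s + e})"
    by (simp add: if_distrib)
qed

lemma T_max_ge:
  assumes "vortex_solution m X0 {0..t} X" "0 \<le> t"
  shows "ereal t \<le> T_max m X0"
  unfolding T_max_def using assms by (intro Sup_upper) auto

lemma vortex_solution_subset:
  assumes "vortex_solution m X0 S X" "S' \<subseteq> S"
  shows "vortex_solution m X0 S' X"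
  using assms unfolding vortex_solution_def
  by (meson has_vector_derivative_within_subset subsetD)

lemma T_max_pos:
  assumes "X0 \<in> distinct_configs"
  shows "0 < T_max m X0"
proof -
  obtain \<delta> where "0 < \<delta>" "separated \<delta> X0" using distinct_imp_separated[OF assms] by blast
  then obtain e X where "0 < e" "vortex_solution m X0 {0..e} X"
    using vortex_local_existence by metis
  then have "ereal e \<le> T_max m X0" by (intro T_max_ge) auto
  with \<open>0 < e\<close> show ?thesis using ereal_less(2) less_le_trans by blast
qed

text \<open>A solution whose vortices stay apart could be continued by a uniform amount of time,
  so close to the maximal time no configuration is \<open>\<delta>\<close>-separated.\<close>

lemma not_separated_near_T_max:
  assumes sol: "vortex_solution m X0 {0..<T} X" and T: "T_max m X0 = ereal T"
    and "0 < T" "0 < \<delta>"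
  shows "\<forall>\<^sub>F t in at_left T. \<not> separated \<delta> (X t)"
proof -
  obtain e where e: "0 < e" "\<And>Y0. separated \<delta> Y0 \<Longrightarrow> \<exists>Y. vortex_solution m Y0 {0..e} Y"
    using vortex_local_existence[OF \<open>0 < \<delta>\<close>, of m] by blast
  have "\<not> separated \<delta> (X t)" if t: "max 0 (T - e) < t" "t < T" for t
  proof
    assume "separated \<delta> (X t)"
    then obtain Y where Y: "vortex_solution m (X t) {0..e} Y" using e by blast
    have "vortex_solution m X0 {0..t} X"
      using sol by (rule vortex_solution_subset) (use t in auto)
    from T_max_ge[OF vortex_solution_append[OF this Y]] t e T show False by simp
  qed
  then show ?thesis
    using eventually_at_left_real[of "max 0 (T - e)" T] \<open>0 < T\<close> \<open>0 < e\<close>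
    by (auto elim: eventually_mono)
qed

section \<open>Scalar linear differential equations\<close>

text \<open>The integrating factor \<open>exp (- integral {0..s} h)\<close> turns \<open>u\<close>
  into a function with zero derivative.\<close>

lemma linear_ode_solution:
  fixes u h :: "real \<Rightarrow> real"
  assumes "0 \<le> t" and h: "continuous_on {0..t} h"
    and u: "\<And>s. s \<in> {0..t} \<Longrightarrow> (u has_real_derivative h s * u s) (at s within {0..t})"
  shows "u t = u 0 * exp (integral {0..t} h)"
proof -
  let ?v = "\<lambda>s. u s * exp (- integral {0..s} h)"
  have "(?v has_real_derivative 0) (at s within {0..t})" if "s \<in> {0..t}" for s
  proof -
    have "((\<lambda>s. integral {0..s} h) has_real_derivative h s) (at s within {0..t})"
      using integral_has_real_derivative[OF h that] .
    then show ?thesis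
      using u[OF that] by (auto intro!: derivative_eq_intros)
  qed
  then obtain c where "?v s = c" if "s \<in> {0..t}" for s
    using has_field_derivative_zero_constant[of "{0..t}" ?v] by (auto simp: convex_real_interval)
  from this[of 0] this[of t] have "u 0 = u t * exp (- integral {0..t} h)"
    using \<open>0 \<le> t\<close> by simp
  then show ?thesis by (simp add: exp_minus)
qed

text \<open>Used in two ways: \<open>K = 0\<close> gives the growth of \<open>(B - A) * C\<close>,
  and a negative \<open>K\<close> keeps \<open>C\<close> away from 0 in the isosceles case.\<close>

lemma linear_ode_lower_bound:
  fixes u h :: "real \<Rightarrow> real"
  assumes "0 \<le> t" and h: "continuous_on {0..t} h"
    and u: "\<And>s. s \<in> {0..t} \<Longrightarrow> (u has_real_derivative h s * u s) (at s within {0..t})"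
    and K: "\<And>s. s \<in> {0..t} \<Longrightarrow> K \<le> h s" and "0 \<le> u 0"
  shows "u 0 * exp (K * t) \<le> u t"
proof -
  have "integral {0..t} (\<lambda>_. K) \<le> integral {0..t} h"
    using K by (intro integral_le integrable_continuous_real h) auto
  then have "exp (K * t) \<le> exp (integral {0..t} h)"
    using \<open>0 \<le> t\<close> by (simp add: mult.commute)
  moreover have "u t = u 0 * exp (integral {0..t} h)"
    using assms(1) h u by (rule linear_ode_solution)
  ultimately show ?thesis using \<open>0 \<le> u 0\<close> by (simp add: mult_left_mono)
qed

lemma has_real_derivative_norm_squared:
  fixes f :: "real \<Rightarrow> 'a::real_inner"
  assumes "(f has_vector_derivative f') (at t within S)"
  shows "((\<lambda>t. (norm (f t))\<^sup>2) has_real_derivative 2 * inner (f t) f') (at t within S)"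
proof -
  have "((\<lambda>t. inner (f t) (f t)) has_vector_derivative inner (f t) f' + inner f' (f t)) (at t within S)"
    by (rule bounded_bilinear.has_vector_derivative[OF bounded_bilinear_inner assms assms])
  then show ?thesis
    by (simp add: has_real_derivative_iff_has_vector_derivative power2_norm_eq_inner inner_commute)
qed

section \<open>Evolution of the squared side lengths\<close>

text \<open>The labels are variables, with \<open>q\<close> the vortex of opposite sign, so that
  exchanging the two equal vortices reduces one inequality in case (ii) to the other.
  \<open>T\<close> need not be maximal: shorter intervals are used to show that the maximal time is
  finite.\<close>

locale opposite_vortex_triple =
  fixes m :: "real^3" and X :: "real \<Rightarrow> real^2^3" and X0 :: "real^2^3" and T :: real and p q r :: 3
  assumes pqr: "UNIV = {p, q, r}" "p \<noteq> q" "p \<noteq> r" "q \<noteq> r"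
    and m: "m $ p = 1" "m $ q = - 1" "m $ r = 1"
    and sol: "vortex_solution m X0 {0..<T} X"
begin

definition A where "A t = (dist (X t $ p) (X t $ q))\<^sup>2"
definition B where "B t = (dist (X t $ q) (X t $ r))\<^sup>2"
definition C where "C t = (dist (X t $ p) (X t $ r))\<^sup>2"

lemma init: "X 0 = X0"
  using sol by (simp add: vortex_solution_def)

lemma distinct:
  assumes "t \<in> {0..<T}" "j \<noteq> l"
  shows "X t $ j \<noteq> X t $ l"
  using sol assms unfolding vortex_solution_def distinct_configs_def by blast

lemma ABC_pos:
  assumes "t \<in> {0..<T}"
  shows "0 < A t" "0 < B t" "0 < C t"
  using distinct[OF assms] pqr unfolding A_def B_def C_def by auto

text \<open>The parallelogram law with one diagonal dropped. When \<open>A t = B t\<close> it yields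
  \<open>A t + B t + C t \<le> 6 * A t\<close>, which bounds the equal sides from below.\<close>

lemma C_le: "C t \<le> 2 * A t + 2 * B t"
proof -
  define a b where "a = X t $ p - X t $ q" and "b = X t $ r - X t $ q"
  have "(norm (a - b))\<^sup>2 \<le> (norm (a - b))\<^sup>2 + (norm (a + b))\<^sup>2" by simp
  also have "\<dots> = 2 * (norm a)\<^sup>2 + 2 * (norm b)\<^sup>2"
    by (simp add: power2_norm_eq_inner inner_add inner_diff inner_commute)
  finally show ?thesis
    by (simp add: A_def B_def C_def a_def b_def dist_norm norm_minus_commute)
qed

lemma position_derivative:
  assumes "t \<in> {0..<T}"
  shows "((\<lambda>t. X t $ p) has_vector_derivative 
      2 *\<^sub>R ((1 / C t) *\<^sub>R (X t $ p - X t $ r) - (1 / A t) *\<^sub>R (X t $ p - X t $ q))) (at t within {0..<T})" (is ?P)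
    and "((\<lambda>t. X t $ q) has_vector_derivative
      2 *\<^sub>R ((1 / A t) *\<^sub>R (X t $ p - X t $ q) + (1 / B t) *\<^sub>R (X t $ r - X t $ q))) (at t within {0..<T})" (is ?Q)
    and "((\<lambda>t. X t $ r) has_vector_derivative
      2 *\<^sub>R ((- 1 / C t) *\<^sub>R (X t $ p - X t $ r) - (1 / B t) *\<^sub>R (X t $ r - X t $ q))) (at t within {0..<T})" (is ?R)
proof -
  have "(X has_vector_derivative vortex_field m (X t)) (at t within {0..<T})"
    using sol assms by (simp add: vortex_solution_def)
  then have X': "((\<lambda>t. X t $ j) has_vector_derivative vortex_field m (X t) $ j) (at t within {0..<T})" for j
    by (rule bounded_linear.has_vector_derivative[OF bounded_linear_vec_nth])
  have others: "UNIV - {p} = {q, r}" "UNIV - {q} = {p, r}" "UNIV - {r} = {p, q}"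
    unfolding pqr(1) using pqr(2-4) by auto
  have "vortex_field m (X t) $ p =
      2 *\<^sub>R ((1 / C t) *\<^sub>R (X t $ p - X t $ r) - (1 / A t) *\<^sub>R (X t $ p - X t $ q))"
    using pqr(2-4) by (simp add: vortex_field_def others m A_def C_def dist_norm)
  with X'[of p] show ?P by simp
  have "vortex_field m (X t) $ q = (-2) *\<^sub>R ((1 / A t) *\<^sub>R (X t $ q - X t $ p) + (1 / B t) *\<^sub>R (X t $ q - X t $ r))"
    using pqr(2-4) by (simp add: vortex_field_def others m A_def B_def dist_norm norm_minus_commute)
  also have "\<dots> = 2 *\<^sub>R ((1 / A t) *\<^sub>R (X t $ p - X t $ q) + (1 / B t) *\<^sub>R (X t $ r - X t $ q))"
    by (simp add: algebra_simps)
  finally show ?Q using X'[of q] by simp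
  have "vortex_field m (X t) $ r = 2 *\<^sub>R ((1 / C t) *\<^sub>R (X t $ r - X t $ p) - (1 / B t) *\<^sub>R (X t $ r - X t $ q))"
    using pqr(2-4) by (simp add: vortex_field_def others m C_def B_def dist_norm norm_minus_commute)
  also have "\<dots> = 2 *\<^sub>R ((- 1 / C t) *\<^sub>R (X t $ p - X t $ r) - (1 / B t) *\<^sub>R (X t $ r - X t $ q))"
    by (simp add: algebra_simps)
  finally show ?R using X'[of r] by simp
qed

lemma ABC_derivative:
  assumes t: "t \<in> {0..<T}"
  shows "(A has_real_derivative - 8 + 2 * (C t - A t) / B t + 2 * (A t - B t) / C t) (at t within {0..<T})" (is ?A)
    and "(B has_real_derivative - 8 + 2 * (C t - B t) / A t + 2 * (B t - A t) / C t) (at t within {0..<T})" (is ?B)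
    and "(C has_real_derivative 2 * (A t + B t - C t) * (1 / A t + 1 / B t)) (at t within {0..<T})" (is ?C)
proof -
  define a b where "a = X t $ p - X t $ q" and "b = X t $ r - X t $ q"
  \<comment> \<open>By the law of cosines all inner products of the sides are linear in
    \<open>A\<close>, \<open>B\<close>, \<open>C\<close>; therefore these three quantities satisfy a
    closed system.\<close>
  have inner: "inner a a = A t" "inner b b = B t" "inner a b = (A t + B t - C t) / 2"
      "inner b a = (A t + B t - C t) / 2"
    unfolding A_def B_def C_def a_def b_def dist_norm power2_norm_eq_inner
    by (simp_all add: inner_diff inner_commute algebra_simps)
  have pr: "X t $ p - X t $ r = a - b" by (simp add: a_def b_def)
  note x' = position_derivative[OF t, unfolded pr a_def[symmetric] b_def[symmetric]]
  note pos = ABC_pos[OF t]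
  have "2 * inner a (2 *\<^sub>R ((1 / C t) *\<^sub>R (a - b) - (1 / A t) *\<^sub>R a) -
        2 *\<^sub>R ((1 / A t) *\<^sub>R a + (1 / B t) *\<^sub>R b))
      = - 8 + 2 * (C t - A t) / B t + 2 * (A t - B t) / C t"
    using pos by (simp add: inner inner_add inner_diff) (simp add: field_simps)
  then show ?A
    using has_real_derivative_norm_squared[OF has_vector_derivative_diff[OF x'(1) x'(2)]]
    unfolding A_def[symmetric] dist_norm[symmetric] a_def[symmetric] by simp
  have "2 * inner b (2 *\<^sub>R ((- 1 / C t) *\<^sub>R (a - b) - (1 / B t) *\<^sub>R b) -
        2 *\<^sub>R ((1 / A t) *\<^sub>R a + (1 / B t) *\<^sub>R b))
      = - 8 + 2 * (C t - B t) / A t + 2 * (B t - A t) / C t"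
    using pos by (simp add: inner inner_add inner_diff) (simp add: field_simps)
  then show ?B
    using has_real_derivative_norm_squared[OF has_vector_derivative_diff[OF x'(3) x'(2)]]
    unfolding B_def[symmetric] dist_norm[symmetric] b_def[symmetric] dist_commute[of _ "X _ $ q"]
    by simp
  have "2 * inner (a - b) (2 *\<^sub>R ((1 / C t) *\<^sub>R (a - b) - (1 / A t) *\<^sub>R a) -
        2 *\<^sub>R ((- 1 / C t) *\<^sub>R (a - b) - (1 / B t) *\<^sub>R b))
      = 2 * (A t + B t - C t) * (1 / A t + 1 / B t)"
    using pos by (simp add: inner inner_add inner_diff) (simp add: field_simps)
  then show ?C
    using has_real_derivative_norm_squared[OF has_vector_derivative_diff[OF x'(1) x'(3)]]
    unfolding C_def[symmetric] dist_norm[symmetric] pr by simp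
qed

lemma ABC_continuous:
  "continuous_on {0..<T} A" "continuous_on {0..<T} B" "continuous_on {0..<T} C"
  by (rule DERIV_continuous_on, erule ABC_derivative)+

text \<open>In the sum of the three derivatives the terms over \<open>C\<close> cancel, and the
  remaining quotients combine to 4, leaving \<open>- 16 + 4 = - 12\<close>.\<close>

lemma sum_squares:
  assumes t: "t \<in> {0..<T}"
  shows "A t + B t + C t = A 0 + B 0 + C 0 - 12 * t"
proof -
  let ?f = "\<lambda>t. A t + B t + C t + 12 * t"
  have "(?f has_real_derivative 0) (at s within {0..<T})" if "s \<in> {0..<T}" for s
    using ABC_pos[OF that]
    by (intro DERIV_cong[OF DERIV_add[OF DERIV_add[OF DERIV_add[OF ABC_derivative(1,2)[OF that]]
          ABC_derivative(3)[OF that]] DERIV_cmult_Id]]) (simp add: field_simps)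
  then obtain c where "?f s = c" if "s \<in> {0..<T}" for s
    using has_field_derivative_zero_constant[of "{0..<T}" ?f] by (auto simp: convex_real_interval)
  from this[of 0] this[of t] show ?thesis using t by simp
qed

text \<open>The key monotone quantity: the factor \<open>C\<close> turns the growth rate of \<open>B - A\<close>,
  which has no definite sign, into a sum of squares.\<close>

lemma asymmetry_derivative:
  assumes t: "t \<in> {0..<T}"
  shows "((\<lambda>t. (B t - A t) * C t) has_real_derivative
     (2 * (C t - A t - B t)\<^sup>2 / (A t * B t * C t) + 4 / C t) * ((B t - A t) * C t)) (at t within {0..<T})"
  using ABC_pos[OF t]
  by (intro DERIV_cong[OF DERIV_mult[OF DERIV_diff[OF ABC_derivative(2,1)[OF t]] ABC_derivative(3)[OF t]]])
     (simp add: field_simps power2_eq_square)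

lemma asymmetry_continuous:
  "continuous_on {0..<T} (\<lambda>t. 2 * (C t - A t - B t)\<^sup>2 / (A t * B t * C t) + 4 / C t)"
  using ABC_pos by (intro continuous_intros ABC_continuous) (auto simp: less_imp_neq[symmetric])

text \<open>The growth rate of \<open>(B - A) * C\<close> is a sum of nonnegative terms, so the
  lower bound holds with exponent 0.\<close>

lemma asymmetry_mono:
  assumes t: "t \<in> {0..<T}" and "A 0 \<le> B 0"
  shows "(B 0 - A 0) * C 0 \<le> (B t - A t) * C t"
proof -
  have sub: "{0..t} \<subseteq> {0..<T}" using t by auto
  have "(B 0 - A 0) * C 0 * exp (0 * t) \<le> (B t - A t) * C t"
  proof (rule linear_ode_lower_bound)
    fix s assume "s \<in> {0..t}"
    with sub have s: "s \<in> {0..<T}" by auto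
    show "((\<lambda>t. (B t - A t) * C t) has_real_derivative
        (2 * (C s - A s - B s)\<^sup>2 / (A s * B s * C s) + 4 / C s) * ((B s - A s) * C s)) (at s within {0..t})"
      using asymmetry_derivative[OF s] sub by (rule DERIV_subset)
    show "0 \<le> 2 * (C s - A s - B s)\<^sup>2 / (A s * B s * C s) + 4 / C s"
      using ABC_pos[OF s] by simp
  qed (use t assms ABC_pos[of 0] continuous_on_subset[OF asymmetry_continuous sub] in auto)
  then show ?thesis by simp
qed

text \<open>A solution of a homogeneous linear equation that starts at 0 stays at 0. This takes the
  place of a reflection argument based on uniqueness for the vortex equations.\<close>

lemma isosceles_preserved:
  assumes t: "t \<in> {0..<T}" and "A 0 = B 0"
  shows "A t = B t"
proof -
  have sub: "{0..t} \<subseteq> {0..<T}" using t by auto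
  have "(B t - A t) * C t = (B 0 - A 0) * C 0 *
      exp (integral {0..t} (\<lambda>s. 2 * (C s - A s - B s)\<^sup>2 / (A s * B s * C s) + 4 / C s))"
    using t sub
    by (intro linear_ode_solution continuous_on_subset[OF asymmetry_continuous]
          DERIV_subset[OF asymmetry_derivative]) auto
  then show ?thesis using ABC_pos[OF t] \<open>A 0 = B 0\<close> by simp
qed

text \<open>Pair interactions are antisymmetric, so they cancel in the sum of the
  velocities.\<close>

lemma barycenter_preserved:
  assumes t: "t \<in> {0..<T}"
  shows "X t $ p + X t $ q + X t $ r = X0 $ p + X0 $ q + X0 $ r"
proof -
  let ?f = "\<lambda>t. X t $ p + X t $ q + X t $ r"
  have "(?f has_vector_derivative 0) (at s within {0..<T})" if "s \<in> {0..<T}" for s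
    using has_vector_derivative_add[OF has_vector_derivative_add[OF position_derivative(1,2)[OF that]]
      position_derivative(3)[OF that]] by (simp add: algebra_simps)
  then obtain c where "?f s = c" if "s \<in> {0..<T}" for s
    using has_derivative_zero_constant[of "{0..<T}" ?f]
    unfolding has_vector_derivative_def by (auto simp: convex_real_interval)
  from this[of 0] this[of t] show ?thesis using t by (simp add: init)
qed

text \<open>Otherwise the sum of squares would vanish at a time when all sides are still
  positive.\<close>

lemma T_le:
  assumes "0 < T"
  shows "T \<le> (A 0 + B 0 + C 0) / 12"
proof (rule ccontr)
  define h where "h = A 0 + B 0 + C 0"
  assume "\<not> T \<le> (A 0 + B 0 + C 0) / 12"
  then have t: "h / 12 \<in> {0..<T}"
    using ABC_pos[of 0] assms by (simp add: h_def)
  have "A (h / 12) + B (h / 12) + C (h / 12) = 0"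
    using sum_squares[OF t] by (simp flip: h_def)
  then show False
    using ABC_pos[OF t] by simp
qed

lemma separatedI:
  assumes "\<delta> \<le> dist (X t $ p) (X t $ q)" "\<delta> \<le> dist (X t $ q) (X t $ r)" "\<delta> \<le> dist (X t $ p) (X t $ r)"
  shows "separated \<delta> (X t)"
  unfolding separated_def
proof (intro allI impI)
  fix j l :: 3 assume "j \<noteq> l"
  moreover have "j \<in> {p, q, r}" "l \<in> {p, q, r}" unfolding pqr(1)[symmetric] by auto
  ultimately show "\<delta> \<le> dist (X t $ j) (X t $ l)"
    using assms by (auto simp: dist_commute)
qed

end

section \<open>Behavior at the maximal time; the isosceles case\<close>

lemma at_within_Ico_at_left:
  fixes a b :: real
  assumes "a < b"
  shows "at b within {a..<b} = at_left b"
  by (rule at_within_nhd[where S="{a<..}"]) (use assms in auto)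

text \<open>Before \<open>T\<close> the solution is continuous and its vortices are distinct, so two
  of them cannot share a limit. Every cluster must therefore form at \<open>T\<close>
  itself.\<close>

lemma collision_cluster_at_less_T:
  fixes X :: "real \<Rightarrow> real^2^'n::finite"
  assumes sol: "vortex_solution m X0 {0..<T} X" and Tc: "Tc < T"
  shows "\<not> collision_cluster_at T' X I Tc P"
proof
  assume cl: "collision_cluster_at T' X I Tc P"
  then have "2 \<le> card I" and "0 < Tc" and lim: "\<And>j. j \<in> I \<Longrightarrow> ((\<lambda>t. X t $ j) \<longlongrightarrow> P) (at_left Tc)"
    by (auto simp: collision_cluster_at_def)
  then obtain j l where jl: "j \<in> I" "l \<in> I" "j \<noteq> l"
    by (metis card_2_iff' card_le_Suc0_iff_eq finite not_less_eq_eq numeral_2_eq_2)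
  have "(X has_vector_derivative vortex_field m (X Tc)) (at Tc within {0..<T})"
    using sol \<open>0 < Tc\<close> Tc by (simp add: vortex_solution_def)
  then have "(X has_vector_derivative vortex_field m (X Tc)) (at Tc within {0..<Tc})"
    by (rule has_vector_derivative_within_subset) (use Tc in auto)
  then have "(X \<longlongrightarrow> X Tc) (at_left Tc)"
    using has_vector_derivative_continuous \<open>0 < Tc\<close>
    by (metis at_within_Ico_at_left continuous_within)
  then have "((\<lambda>t. X t $ i) \<longlongrightarrow> X Tc $ i) (at_left Tc)" for i
    by (rule tendsto_vec_nth)
  with lim jl have "X Tc $ j = P" "X Tc $ l = P"
    by (meson tendsto_unique trivial_limit_at_left_real)+
  moreover have "X Tc \<in> distinct_configs"
    using sol \<open>0 < Tc\<close> Tc by (simp add: vortex_solution_def)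
  ultimately show False
    using jl by (auto simp: distinct_configs_def)
qed

locale maximal_opposite_vortex_triple = opposite_vortex_triple +
  assumes T_max: "T_max m X0 = ereal T" and T_pos: "0 < T"
begin

lemma near_T: "\<forall>\<^sub>F t in at_left T. t \<in> {0..<T}"
  using eventually_at_left_real[OF T_pos] by (auto elim: eventually_mono)

text \<open>If \<open>T\<close> came earlier, the sum of squares would stay above some
  \<open>h > 0\<close>. All three sides would then be bounded below up to \<open>T\<close>,
  contradicting \<open>not_separated_near_T_max\<close>.\<close>

lemma isosceles_collision_time:
  assumes "A 0 = B 0"
  shows "T = (A 0 + B 0 + C 0) / 12"
proof (rule ccontr)
  let ?H = "A 0 + B 0 + C 0"
  assume "T \<noteq> ?H / 12"
  with T_le[OF T_pos] have "T < ?H / 12" by simp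
  define h where "h = ?H - 12 * T"
  have h: "0 < h" using \<open>T < ?H / 12\<close> by (simp add: h_def)
  have A_ge: "h / 6 \<le> A t" and AB: "A t = B t" if t: "t \<in> {0..<T}" for t
    using sum_squares[OF t] C_le[of t] isosceles_preserved[OF t assms] t by (auto simp: h_def)
  \<comment> \<open>For \<open>A = B\<close> the equation for \<open>C\<close> reads
    \<open>C' = (8 / C - 4 / A) * C\<close>. Dropping \<open>8 / C\<close> and using
    \<open>A \<ge> h / 6\<close> gives the decay rate of at most \<open>24 / h\<close>.\<close>
  define c where "c = C 0 * exp (- (24 / h) * T)"
  have c: "0 < c" using ABC_pos(3)[of 0] T_pos by (simp add: c_def)
  have C_ge: "c \<le> C t" if t: "t \<in> {0..<T}" for t
  proof -
    have sub: "{0..t} \<subseteq> {0..<T}" using t by auto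
    have "C 0 * exp (- (24 / h) * t) \<le> C t"
    proof (rule linear_ode_lower_bound)
      have "continuous_on {0..<T} (\<lambda>s. 8 / C s - 4 / A s)"
        using ABC_pos by (intro continuous_intros ABC_continuous) (auto simp: less_imp_neq[symmetric])
      then show "continuous_on {0..t} (\<lambda>s. 8 / C s - 4 / A s)"
        using sub by (rule continuous_on_subset)
    next
      fix s assume "s \<in> {0..t}"
      with sub have s: "s \<in> {0..<T}" by auto
      have "(C has_real_derivative (8 / C s - 4 / A s) * C s) (at s within {0..<T})"
        using ABC_pos[OF s]
        by (intro DERIV_cong[OF ABC_derivative(3)[OF s]]) (simp add: AB[OF s, symmetric] field_simps)
      then show "(C has_real_derivative (8 / C s - 4 / A s) * C s) (at s within {0..t})"
        using sub by (rule DERIV_subset)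
      have "4 / A s \<le> 4 / (h / 6)"
        using A_ge[OF s] h by (intro divide_left_mono) (auto intro!: mult_pos_pos)
      then have "4 / A s \<le> 24 / h" by simp
      then show "- (24 / h) \<le> 8 / C s - 4 / A s"
        using divide_pos_pos[OF _ ABC_pos(3)[OF s], of 8] by linarith
    qed (use t ABC_pos[of 0] in auto)
    moreover have "c \<le> C 0 * exp (- (24 / h) * t)"
      unfolding c_def using t h ABC_pos[of 0] by (intro mult_left_mono) (auto simp: divide_right_mono)
    ultimately show ?thesis by linarith
  qed
  define \<delta> where "\<delta> = sqrt (min (h / 6) c)"
  have "separated \<delta> (X t)" if t: "t \<in> {0..<T}" for t
  proof (rule separatedI)
    have "\<delta> \<le> sqrt (A t)" "\<delta> \<le> sqrt (B t)" "\<delta> \<le> sqrt (C t)"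
      unfolding \<delta>_def using A_ge[OF t] AB[OF t] C_ge[OF t] by auto
    then show "\<delta> \<le> dist (X t $ p) (X t $ q)" "\<delta> \<le> dist (X t $ q) (X t $ r)" "\<delta> \<le> dist (X t $ p) (X t $ r)"
      by (simp_all add: A_def B_def C_def)
  qed
  moreover have "\<forall>\<^sub>F t in at_left T. \<not> separated \<delta> (X t)"
    using h c by (intro not_separated_near_T_max[OF sol T_max T_pos]) (simp add: \<delta>_def)
  ultimately have "\<forall>\<^sub>F t in at_left T. t \<notin> {0..<T}"
    by (auto elim!: eventually_mono)
  with near_T have "\<forall>\<^sub>F t in at_left T. False"
    by eventually_elim blast
  then show False by simp
qed

lemma total_collision:
  assumes "T = (A 0 + B 0 + C 0) / 12"
  shows "((\<lambda>t. X t $ j) \<longlongrightarrow> (1 / 3) *\<^sub>R (X0 $ p + X0 $ q + X0 $ r)) (at_left T)"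
proof -
  define S where "S = X0 $ p + X0 $ q + X0 $ r"
  have "((\<lambda>t. sqrt (A 0 + B 0 + C 0 - 12 * t)) \<longlongrightarrow> sqrt (A 0 + B 0 + C 0 - 12 * T)) (at_left T)"
    by (intro tendsto_intros)
  moreover have "A 0 + B 0 + C 0 - 12 * T = 0" unfolding assms by (simp only: times_divide_eq_right nonzero_mult_div_cancel_left)
  ultimately have lim: "((\<lambda>t. sqrt (A 0 + B 0 + C 0 - 12 * t)) \<longlongrightarrow> 0) (at_left T)"
    by simp
  have "\<forall>\<^sub>F t in at_left T. norm (X t $ j - (1 / 3) *\<^sub>R S) \<le> sqrt (A 0 + B 0 + C 0 - 12 * t)"
    using near_T
  proof eventually_elim
    case t: (elim t)
    let ?H = "A t + B t + C t"
    note pos = ABC_pos[OF t]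
    have d: "dist (X t $ k) (X t $ l) \<le> sqrt ?H" for k l
    proof -
      have "k \<in> {p, q, r}" "l \<in> {p, q, r}" unfolding pqr(1)[symmetric] by auto
      moreover have "dist (X t $ p) (X t $ q) \<le> sqrt ?H" "dist (X t $ q) (X t $ r) \<le> sqrt ?H"
        "dist (X t $ p) (X t $ r) \<le> sqrt ?H"
        using pos by (auto intro!: real_le_rsqrt simp flip: A_def B_def C_def)
      ultimately show ?thesis using pos by (auto simp: dist_commute)
    qed
    \<comment> \<open>The deviation from the barycenter is the mean of the differences to the three
      vortices, each at most the root of the sum of squares.\<close>
    have "X t $ j - (1 / 3) *\<^sub>R S
        = (1 / 3) *\<^sub>R ((X t $ j - X t $ p) + (X t $ j - X t $ q) + (X t $ j - X t $ r))"
      unfolding S_def barycenter_preserved[OF t, symmetric]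
      by (simp add: vec_eq_iff field_simps)
    also have "norm \<dots> \<le> (1 / 3) * (sqrt ?H + sqrt ?H + sqrt ?H)"
      unfolding norm_scaleR by (intro mult_mono norm_triangle_mono d[unfolded dist_norm]) simp_all
    finally show ?case unfolding sum_squares[OF t] by simp
  qed
  then have "((\<lambda>t. X t $ j - (1 / 3) *\<^sub>R S) \<longlongrightarrow> 0) (at_left T)"
    by (rule Lim_null_comparison[OF _ lim])
  then show ?thesis unfolding S_def by (simp add: LIM_zero_iff)
qed

section \<open>The asymmetric case: collision of the closer pair\<close>

context
  assumes less: "A 0 < B 0"
begin

text \<open>The initial value of the increasing quantity \<open>(B - A) * C\<close>, divided by the
  initial sum of squares, which bounds every squared side at all times.\<close>

definition \<delta>\<^sub>0 where "\<delta>\<^sub>0 = (B 0 - A 0) * C 0 / (A 0 + B 0 + C 0)"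

lemma \<delta>\<^sub>0_pos: "0 < \<delta>\<^sub>0"
  using less ABC_pos[of 0] T_pos by (simp add: \<delta>\<^sub>0_def)

lemma BC_ge:
  assumes t: "t \<in> {0..<T}"
  shows "\<delta>\<^sub>0 \<le> B t" "\<delta>\<^sub>0 \<le> C t"
proof -
  let ?H = "A 0 + B 0 + C 0"
  note pos = ABC_pos[OF t]
  have H: "A t \<le> ?H" "B t \<le> ?H" "C t \<le> ?H" "0 < ?H"
    using sum_squares[OF t] pos t by auto
  have *: "\<delta>\<^sub>0 * ?H \<le> (B t - A t) * C t"
    using asymmetry_mono[OF t] less H by (simp add: \<delta>\<^sub>0_def)
  \<comment> \<open>Bounding one factor at a time by the initial sum isolates \<open>B t\<close> and
    \<open>C t\<close>; division then produces \<open>\<delta>\<^sub>0\<close>.\<close>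
  have "(B t - A t) * C t \<le> B t * ?H" "(B t - A t) * C t \<le> ?H * C t"
    using pos H by (auto intro!: mult_mono mult_right_mono)
  with * show "\<delta>\<^sub>0 \<le> B t" "\<delta>\<^sub>0 \<le> C t"
    using H(4) by (auto simp: mult.commute[of ?H] dest!: order_trans[OF *])
qed

text \<open>The sum of squares stays above \<open>\<delta>\<^sub>0\<close> until \<open>T\<close>,
  which leaves a margin of \<open>\<delta>\<^sub>0 / 12\<close> in time.\<close>

lemma collision_time_less: "T < (A 0 + B 0 + C 0) / 12"
proof -
  have "t \<le> (A 0 + B 0 + C 0 - \<delta>\<^sub>0) / 12" if "0 < t" "t < T" for t
    using BC_ge[of t] ABC_pos[of t] sum_squares[of t] that by simp
  then have "T \<le> (A 0 + B 0 + C 0 - \<delta>\<^sub>0) / 12"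
    by (rule dense_le_bounded[OF T_pos])
  with \<delta>\<^sub>0_pos show ?thesis by simp
qed

text \<open>Separation fails at every scale near \<open>T\<close>, and the sides at \<open>r\<close>
  cannot be responsible. Since it fails at all times close to \<open>T\<close>, this gives a true
  limit and not merely a limit inferior.\<close>

lemma pair_dist_tendsto_0: "((\<lambda>t. X t $ p - X t $ q) \<longlongrightarrow> 0) (at_left T)"
proof (rule tendstoI)
  fix \<epsilon> :: real assume "0 < \<epsilon>"
  have "\<forall>\<^sub>F t in at_left T. \<not> separated (min \<epsilon> (sqrt \<delta>\<^sub>0)) (X t)"
    using \<open>0 < \<epsilon>\<close> \<delta>\<^sub>0_pos by (intro not_separated_near_T_max[OF sol T_max T_pos]) simp
  with near_T show "\<forall>\<^sub>F t in at_left T. dist (X t $ p - X t $ q) 0 < \<epsilon>"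
  proof eventually_elim
    case (elim t)
    have "sqrt \<delta>\<^sub>0 \<le> sqrt (B t)" "sqrt \<delta>\<^sub>0 \<le> sqrt (C t)"
      using BC_ge[OF elim(1)] by auto
    then have "sqrt \<delta>\<^sub>0 \<le> dist (X t $ q) (X t $ r)" "sqrt \<delta>\<^sub>0 \<le> dist (X t $ p) (X t $ r)"
      by (simp_all add: B_def C_def)
    then have "separated (min \<epsilon> (sqrt \<delta>\<^sub>0)) (X t)" if "\<epsilon> \<le> dist (X t $ p) (X t $ q)"
      by (intro separatedI min.coboundedI2 min.coboundedI1[OF that])
    with elim(2) have "dist (X t $ p) (X t $ q) < \<epsilon>" by (meson not_less)
    then show ?case by (simp add: dist_norm)
  qed
qed

lemma outsider_converges: "\<exists>z. ((\<lambda>t. X t $ r) \<longlongrightarrow> z) (at_left T)"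
proof -
  let ?v = "\<lambda>t. 2 *\<^sub>R ((- 1 / C t) *\<^sub>R (X t $ p - X t $ r) - (1 / B t) *\<^sub>R (X t $ r - X t $ q))"
  \<comment> \<open>Two interaction terms of size at most \<open>1 / sqrt \<delta>\<^sub>0\<close>,
    each with the factor 2 of the field. A Lipschitz curve extends continuously to the end
    point.\<close>
  have "(4 / sqrt \<delta>\<^sub>0)-lipschitz_on {0..<T} (\<lambda>t. X t $ r)"
  proof (rule bounded_derivative_imp_lipschitz)
    fix t assume t: "t \<in> {0..<T}"
    show "((\<lambda>t. X t $ r) has_derivative (\<lambda>x. x *\<^sub>R ?v t)) (at t within {0..<T})"
      using position_derivative(3)[OF t] by (simp add: has_vector_derivative_def)
    note pos = ABC_pos[OF t]
    have inv: "norm ((1 / (norm x)\<^sup>2) *\<^sub>R x) \<le> 1 / sqrt \<delta>\<^sub>0" if "\<delta>\<^sub>0 \<le> (norm x)\<^sup>2" for x :: "real^2"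
    proof -
      have "sqrt \<delta>\<^sub>0 \<le> norm x" using real_sqrt_le_mono[OF that] by simp
      then show ?thesis
        using \<delta>\<^sub>0_pos by (cases "x = 0") (auto simp: power2_eq_square intro!: divide_left_mono)
    qed
    have "norm ((1 / C t) *\<^sub>R (X t $ p - X t $ r)) \<le> 1 / sqrt \<delta>\<^sub>0"
      using inv[of "X t $ p - X t $ r"] BC_ge(2)[OF t] by (simp add: C_def dist_norm)
    moreover have "norm ((1 / B t) *\<^sub>R (X t $ r - X t $ q)) \<le> 1 / sqrt \<delta>\<^sub>0"
      using inv[of "X t $ r - X t $ q"] BC_ge(1)[OF t]
      by (simp add: B_def dist_norm norm_minus_commute)
    moreover have "norm (?v t) \<le> 2 * (norm ((1 / C t) *\<^sub>R (X t $ p - X t $ r)) + norm ((1 / B t) *\<^sub>R (X t $ r - X t $ q)))"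
      unfolding norm_scaleR[of 2] by (intro mult_mono norm_triangle_le_diff) simp_all
    ultimately have "norm (?v t) \<le> 4 / sqrt \<delta>\<^sub>0" by simp
    then show "onorm (\<lambda>x. x *\<^sub>R ?v t) \<le> 4 / sqrt \<delta>\<^sub>0"
      by (intro onorm_le) (simp only: norm_scaleR real_norm_def mult.commute[of "\<bar>_\<bar>"] mult_right_mono abs_ge_zero)
  qed (use \<delta>\<^sub>0_pos in \<open>auto simp: convex_real_interval\<close>)
  then have "uniformly_continuous_on {0..<T} (\<lambda>t. X t $ r)"
    by (rule lipschitz_on_uniformly_continuous)
  moreover have "T \<in> closure {0..<T}"
    using T_pos by simp
  ultimately obtain z where "((\<lambda>t. X t $ r) \<longlongrightarrow> z) (at T within {0..<T})"
    by (rule uniformly_continuous_on_extension_at_closure)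
  then show ?thesis
    unfolding at_within_Ico_at_left[OF T_pos] ..
qed

text \<open>With fixed sum \<open>S\<close> of the positions, the position of \<open>p\<close> is
  half of \<open>S - X t $ r\<close> plus half the vanishing difference of the pair. The bound on
  \<open>C\<close> survives in the limit and separates \<open>P\<close> from
  \<open>z\<close>.\<close>

lemma limits:
  "\<exists>P z. P \<noteq> z \<and> ((\<lambda>t. X t $ p) \<longlongrightarrow> P) (at_left T) \<and> ((\<lambda>t. X t $ q) \<longlongrightarrow> P) (at_left T)
    \<and> ((\<lambda>t. X t $ r) \<longlongrightarrow> z) (at_left T)"
proof -
  obtain z where z: "((\<lambda>t. X t $ r) \<longlongrightarrow> z) (at_left T)" using outsider_converges by blast
  define S where "S = X0 $ p + X0 $ q + X0 $ r"
  define P where "P = (1 / 2) *\<^sub>R (S - z)"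
  have "((\<lambda>t. (1 / 2) *\<^sub>R (S - X t $ r) + (1 / 2) *\<^sub>R (X t $ p - X t $ q)) \<longlongrightarrow> P + (1 / 2) *\<^sub>R 0) (at_left T)"
    unfolding P_def by (intro tendsto_intros z pair_dist_tendsto_0)
  moreover have "\<forall>\<^sub>F t in at_left T. (1 / 2) *\<^sub>R (S - X t $ r) + (1 / 2) *\<^sub>R (X t $ p - X t $ q) = X t $ p"
    using near_T
  proof eventually_elim
    case (elim t)
    have "S - X t $ r + (X t $ p - X t $ q) = 2 *\<^sub>R X t $ p"
      unfolding S_def barycenter_preserved[OF elim, symmetric] by (simp add: scaleR_2)
    then show ?case by (simp flip: scaleR_add_right)
  qed
  ultimately have "((\<lambda>t. X t $ p) \<longlongrightarrow> P + (1 / 2) *\<^sub>R 0) (at_left T)"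
    by (rule Lim_transform_eventually)
  then have P: "((\<lambda>t. X t $ p) \<longlongrightarrow> P) (at_left T)" by simp
  from tendsto_diff[OF P pair_dist_tendsto_0] have Q: "((\<lambda>t. X t $ q) \<longlongrightarrow> P) (at_left T)"
    by simp
  have "((\<lambda>t. C t) \<longlongrightarrow> (dist P z)\<^sup>2) (at_left T)"
    unfolding C_def by (intro tendsto_intros P z)
  moreover have "\<forall>\<^sub>F t in at_left T. \<delta>\<^sub>0 \<le> C t"
    using near_T by eventually_elim (rule BC_ge(2))
  ultimately have "\<delta>\<^sub>0 \<le> (dist P z)\<^sup>2"
    by (rule tendsto_lowerbound) simp
  with \<delta>\<^sub>0_pos have "P \<noteq> z" by auto
  with P Q z show ?thesis by blast
qed

lemma pair_collision:
  "(\<exists>P. collision_cluster_at (ereal T) X {p, q} T P) \<and> (\<forall>I. collision_cluster (ereal T) X I \<longleftrightarrow> I = {p, q})"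
proof -
  obtain P z where "P \<noteq> z" and P: "((\<lambda>t. X t $ p) \<longlongrightarrow> P) (at_left T)"
    and Q: "((\<lambda>t. X t $ q) \<longlongrightarrow> P) (at_left T)" and z: "((\<lambda>t. X t $ r) \<longlongrightarrow> z) (at_left T)"
    using limits by blast
  have cl: "collision_cluster_at (ereal T) X {p, q} T P"
    unfolding collision_cluster_at_def
  proof (intro conjI allI impI)
    show "2 \<le> card {p, q}" using pqr by simp
    show "\<forall>j\<in>{p, q}. ((\<lambda>t. X t $ j) \<longlongrightarrow> P) (at_left T)" using P Q by simp
    fix l assume "l \<notin> {p, q}"
    moreover have "l \<in> {p, q, r}" unfolding pqr(1)[symmetric] by simp
    ultimately have l: "l = r" by simp
    show "0 < (MIN j\<in>{p, q}. dist (X t $ j) (X t $ l))" if "0 \<le> t \<and> t < T" for t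
      using that distinct[of t] pqr by (simp add: l)
    have "((\<lambda>t. min (dist (X t $ p) (X t $ r)) (dist (X t $ q) (X t $ r))) \<longlongrightarrow> min (dist P z) (dist P z)) (at_left T)"
      by (intro tendsto_intros P Q z)
    then show "\<exists>d>0. ((\<lambda>t. MIN j\<in>{p, q}. dist (X t $ j) (X t $ l)) \<longlongrightarrow> d) (at_left T)"
      using \<open>P \<noteq> z\<close> by (intro exI[of _ "dist P z"]) (simp add: l)
  qed (use T_pos distinct in auto)
  \<comment> \<open>Any cluster forms at \<open>T\<close>. The limit of \<open>r\<close> differs
    from the common limit of \<open>p\<close> and \<open>q\<close>, so \<open>r\<close> cannot
    belong to a set of at least two vortices with one limit.\<close>
  have "I = {p, q}" if cluster: "collision_cluster (ereal T) X I" for I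
  proof -
    obtain Tc P' where I: "collision_cluster_at (ereal T) X I Tc P'"
      using cluster by (auto simp: collision_cluster_def)
    then have "Tc \<le> T" by (simp add: collision_cluster_at_def)
    with I collision_cluster_at_less_T[OF sol] have "Tc = T"
      using order_le_less by blast
    with I have "2 \<le> card I" and lim: "\<And>j. j \<in> I \<Longrightarrow> ((\<lambda>t. X t $ j) \<longlongrightarrow> P') (at_left T)"
      by (auto simp: collision_cluster_at_def)
    have unique: "u = v" if "(f \<longlongrightarrow> u) (at_left T)" "(f \<longlongrightarrow> v) (at_left T)" for f and u v :: "real^2"
      using tendsto_unique[OF trivial_limit_at_left_real that] .
    have "I \<subseteq> {p, q, r}" unfolding pqr(1)[symmetric] by simp
    moreover have "r \<notin> I"
    proof
      assume "r \<in> I"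
      with lim z have "P' = z" using unique by blast
      moreover have "I \<noteq> {r}" using \<open>2 \<le> card I\<close> by auto
      with \<open>r \<in> I\<close> \<open>I \<subseteq> {p, q, r}\<close> have "p \<in> I \<or> q \<in> I" by blast
      with lim P Q have "P' = P" using unique by blast
      ultimately show False using \<open>P \<noteq> z\<close> by simp
    qed
    ultimately have "I \<subseteq> {p, q}" by blast
    moreover have "card {p, q} \<le> card I" using \<open>2 \<le> card I\<close> pqr by simp
    ultimately show ?thesis by (simp add: card_seteq)
  qed
  with cl show ?thesis by (auto simp: collision_cluster_def)
qed

end

end

section \<open>Finiteness of the maximal time and the three cases\<close>

theorem theorem3p3:
  fixes m :: "real^3" and X0 :: "real^2^3" and X :: "real \<Rightarrow> real^2^3" and T :: ereal
  assumes "m $ 1 = 1" and "m $ 2 = - 1" and "m $ 3 = 1"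
    and "X0 \<in> distinct_configs"
    and "T = T_max m X0"
    and "vortex_solution m X0 {t. 0 \<le> t \<and> ereal t < T} X"
  shows
    "(dist (X0 $ 1) (X0 $ 2) = dist (X0 $ 2) (X0 $ 3) \<longrightarrow>
        collision_cluster T X {1, 2, 3} \<and>
        T = ereal (H1 X0 / 12) \<and>
        collision_cluster_at T X {1, 2, 3} (real_of_ereal T) (barycenter X0)) \<and>
     (dist (X0 $ 1) (X0 $ 2) < dist (X0 $ 2) (X0 $ 3) \<longrightarrow>
        (\<forall>I. collision_cluster T X I \<longleftrightarrow> I = {1, 2}) \<and>
        (\<exists>p. collision_cluster_at T X {1, 2} (real_of_ereal T) p) \<and>
        0 < T \<and> T < ereal (H1 X0 / 12)) \<and>
     (dist (X0 $ 1) (X0 $ 2) > dist (X0 $ 2) (X0 $ 3) \<longrightarrow>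
        (\<forall>I. collision_cluster T X I \<longleftrightarrow> I = {2, 3}) \<and>
        (\<exists>p. collision_cluster_at T X {2, 3} (real_of_ereal T) p) \<and>
        0 < T \<and> T < ereal (H1 X0 / 12))"
proof -
  have UNIV: "(UNIV :: 3 set) = {1, 2, 3}" "(UNIV :: 3 set) = {3, 2, 1}"
    using UNIV_3 by auto
  have "0 < T" using T_max_pos[OF assms(4)] assms(5) by simp
  \<comment> \<open>\<open>T\<close> may be infinite at this point, so the bound is first shown for
    every real time below \<open>T\<close> by restricting the solution.\<close>
  have "T \<le> ereal (H1 X0 / 12)"
  proof (rule dense_le_bounded[OF \<open>0 < T\<close>])
    fix s assume s: "0 < s" "s < T"
    then obtain t where t: "s = ereal t" by (cases s) auto
    have "{0..<t} \<subseteq> {t. 0 \<le> t \<and> ereal t < T}"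
      using s(2) unfolding t by (auto intro: less_trans[of _ "ereal t"])
    then interpret opposite_vortex_triple m X X0 t 1 2 3
      using assms(1-3) UNIV vortex_solution_subset[OF assms(6)]
      by unfold_locales auto
    show "s \<le> ereal (H1 X0 / 12)"
      using T_le s by (simp add: t A_def B_def C_def H1_def init add.commute add.left_commute)
  qed
  with \<open>0 < T\<close> obtain \<tau> where \<tau>: "T = ereal \<tau>" by (cases T) auto
  have dom: "{t. 0 \<le> t \<and> ereal t < T} = {0..<\<tau>}" by (auto simp: \<tau>)
  have max: "vortex_solution m X0 {0..<\<tau>} X" "T_max m X0 = ereal \<tau>" "0 < \<tau>"
    using assms(6)[unfolded dom] assms(5)[symmetric] \<open>0 < T\<close> unfolding \<tau> by simp_all
  interpret L: maximal_opposite_vortex_triple m X X0 \<tau> 1 2 3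
    using assms(1-3) UNIV max by unfold_locales auto
  \<comment> \<open>Exchanging labels 1 and 3 exchanges \<open>A\<close> and \<open>B\<close>, so
    the second inequality in (ii) becomes the first.\<close>
  interpret R: maximal_opposite_vortex_triple m X X0 \<tau> 3 2 1
    using assms(1-3) UNIV max by unfold_locales auto
  have H: "L.A 0 + L.B 0 + L.C 0 = H1 X0" "R.A 0 + R.B 0 + R.C 0 = H1 X0"
    by (simp_all add: L.A_def L.B_def L.C_def R.A_def R.B_def R.C_def H1_def L.init dist_commute)
  have AB: "L.A 0 = (dist (X0 $ 1) (X0 $ 2))\<^sup>2" "L.B 0 = (dist (X0 $ 2) (X0 $ 3))\<^sup>2"
    "R.A 0 = (dist (X0 $ 2) (X0 $ 3))\<^sup>2" "R.B 0 = (dist (X0 $ 1) (X0 $ 2))\<^sup>2"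
    by (simp_all add: L.A_def L.B_def R.A_def R.B_def L.init dist_commute)
  show ?thesis
  proof (intro conjI impI)
    assume "dist (X0 $ 1) (X0 $ 2) = dist (X0 $ 2) (X0 $ 3)"
    then have T: "\<tau> = H1 X0 / 12"
      using L.isosceles_collision_time AB H by simp
    show "T = ereal (H1 X0 / 12)" by (simp add: \<tau> T)
    have bary: "barycenter X0 = (1 / 3) *\<^sub>R (X0 $ 1 + X0 $ 2 + X0 $ 3)"
      by (simp add: barycenter_def sum_3)
    show cl: "collision_cluster_at T X {1, 2, 3} (real_of_ereal T) (barycenter X0)"
      \<comment> \<open>Since \<open>{1, 2, 3}\<close> is all of \<open>UNIV\<close>, the condition
        on outside vortices is vacuous.\<close>
      unfolding collision_cluster_at_def bary using L.total_collision[unfolded H, OF T] L.T_pos L.distinct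
      by (auto simp: \<tau> UNIV(1)[symmetric])
    show "collision_cluster T X {1, 2, 3}"
      using cl unfolding collision_cluster_def by blast
  next
    assume "dist (X0 $ 1) (X0 $ 2) < dist (X0 $ 2) (X0 $ 3)"
    then have less: "L.A 0 < L.B 0" by (simp add: AB power_strict_mono)
    show "\<forall>I. collision_cluster T X I \<longleftrightarrow> I = {1, 2}"
      using L.pair_collision[OF less] by (simp add: \<tau>)
    show "\<exists>p. collision_cluster_at T X {1, 2} (real_of_ereal T) p"
      using L.pair_collision[OF less] by (simp add: \<tau>)
    show "T < ereal (H1 X0 / 12)"
      using L.collision_time_less[OF less] H by (simp add: \<tau>)
  next
    assume "dist (X0 $ 1) (X0 $ 2) > dist (X0 $ 2) (X0 $ 3)"
    then have less: "R.A 0 < R.B 0" by (simp add: AB power_strict_mono)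
    have 32: "{3, 2} = {2, 3 :: 3}" by auto
    show "\<forall>I. collision_cluster T X I \<longleftrightarrow> I = {2, 3}"
      using R.pair_collision[OF less] by (simp add: \<tau> 32)
    show "\<exists>p. collision_cluster_at T X {2, 3} (real_of_ereal T) p"
      using R.pair_collision[OF less] by (simp add: \<tau> 32)
    show "T < ereal (H1 X0 / 12)"
      using R.collision_time_less[OF less] H by (simp add: \<tau>)
  qed (use \<open>0 < T\<close> in auto)
qed

end
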